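(* Let $m,r,s$ be integers with $1\leq r,s\leq m-3$ and $r+s=m-2$. Then every strongly connected digraph $D$ with minimum semi-degree $\delta(D)=\min\{\delta^+(D),\delta^-(D)\}\geq m+1$ contains a subdigraph $T$ isomorphic to a member of $\{ODS(m;r,s),\ IDS(m;r,s),\ OIDS(m;r,s)\}$ such that $D-V(T)$ is strongly connected.
   Context: Digraphs are finite, without loops and without parallel arcs. A digraph is strongly connected if for every ordered pair of vertices $x,y$ there is a directed path from $x$ to $y$. $\delta^+(D)$, $\delta^-(D)$ are the minimum out-degree and minimum in-degree; $D-V(T)$ is the subdigraph induced by $V(D)\setminus V(T)$. For positive integers $r,s$ with $r+s=m-2$: the out-double-star $ODS(m;r,s)$ has vertices $u,v,a_1,\dots,a_r,b_1,\dots,b_s$ (all distinct) and arcs $(u,v)$, $(u,a_i)$ for all $i$, $(v,b_j)$ for all $j$ (two out-stars rooted at $u$ and $v$ joined by the arc $(u,v)$). The in-double-star $IDS(m;r,s)$ has the same vertices and arcs $(u,v)$, $(a_i,u)$, $(b_j,v)$. The out-in-double-star $OIDS(m;r,s)$ has the same vertices and arcs $(u,v)$, $(u,a_i)$, $(b_j,v)$. *)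

theory Defs
  imports "Graph_Theory.Graph_Theory"
begin

definition min_out_degree :: "('a, 'b) pre_digraph \<Rightarrow> nat" where
  "min_out_degree D = Min (out_degree D ` verts D)"

definition min_in_degree :: "('a, 'b) pre_digraph \<Rightarrow> nat" where
  "min_in_degree D = Min (in_degree D ` verts D)"

definition min_semi_degree :: "('a, 'b) pre_digraph \<Rightarrow> nat" where
  "min_semi_degree D = min (min_out_degree D) (min_in_degree D)"

datatype ds_vert = CentreU | CentreV | LeafA nat | LeafB nat

definition ds_verts :: "nat \<Rightarrow> nat \<Rightarrow> ds_vert set" where
  "ds_verts r s = {CentreU, CentreV} \<union> LeafA ` {1..r} \<union> LeafB ` {1..s}"

text \<open>The double stars below have \<open>m = r + s + 2\<close> vertices; since \<open>m\<close> is
  determined by \<open>r\<close> and \<open>s\<close>, it is not a separate argument.\<close>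

lemma card_ds_verts: "card (ds_verts r s) = r + s + 2"
proof -
  have "card (LeafA ` {1..r} \<union> LeafB ` {1..s}) = r + s"
    by (subst card_Un_disjoint) (auto simp: card_image inj_on_def)
  moreover have "ds_verts r s = insert CentreU (insert CentreV (LeafA ` {1..r} \<union> LeafB ` {1..s}))"
    by (auto simp: ds_verts_def)
  ultimately show ?thesis
    by (auto simp: card_insert_if)
qed

definition ODS :: "nat \<Rightarrow> nat \<Rightarrow> (ds_vert, ds_vert \<times> ds_vert) pre_digraph" where
  "ODS r s = \<lparr> verts = ds_verts r s,
     arcs = {(CentreU, CentreV)} \<union> {(CentreU, LeafA i) | i. i \<in> {1..r}}
       \<union> {(CentreV, LeafB j) | j. j \<in> {1..s}},
     tail = fst, head = snd \<rparr>"

definition IDS :: "nat \<Rightarrow> nat \<Rightarrow> (ds_vert, ds_vert \<times> ds_vert) pre_digraph" where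
  "IDS r s = \<lparr> verts = ds_verts r s,
     arcs = {(CentreU, CentreV)} \<union> {(LeafA i, CentreU) | i. i \<in> {1..r}}
       \<union> {(LeafB j, CentreV) | j. j \<in> {1..s}},
     tail = fst, head = snd \<rparr>"

definition OIDS :: "nat \<Rightarrow> nat \<Rightarrow> (ds_vert, ds_vert \<times> ds_vert) pre_digraph" where
  "OIDS r s = \<lparr> verts = ds_verts r s,
     arcs = {(CentreU, CentreV)} \<union> {(CentreU, LeafA i) | i. i \<in> {1..r}}
       \<union> {(LeafB j, CentreV) | j. j \<in> {1..s}},
     tail = fst, head = snd \<rparr>"

end

theory Submission
  imports Defs
begin

text \<open>
  Let \<open>H\<close> be a maximal vertex set such that \<open>D[H]\<close> is strong and \<open>R = V - H\<close> contains a double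
  star. If the star does not fill \<open>R\<close>, let \<open>A\<close> and \<open>B\<close> be the vertices of \<open>R\<close> with an
  in-neighbour, respectively an out-neighbour, in \<open>H\<close>. By maximality, the vertices of \<open>R\<close> off
  any path in \<open>R\<close> from \<open>A\<close> to \<open>B\<close> contain no double star. A vertex outside \<open>B\<close>
  (outside \<open>A\<close>) has all of its at least \<open>m + 1\<close> out-neighbours (in-neighbours) in \<open>R\<close>. An arc
  whose ends keep out/out, in/in or out/in degrees at least \<open>m - 1\<close> yields a double star, which
  settles paths with at most two vertices. On a shortest path \<open>w\<^sub>0, w\<^sub>1, \<dots>\<close> with at least three
  vertices, every out-neighbour \<open>c\<close> of \<open>w\<^sub>0\<close> off the path sends arcs to at most
  \<open>w\<^sub>0, w\<^sub>1, w\<^sub>2\<close>; the absence of a double star forces all three of these arcs and exactly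
  \<open>m - 2\<close> out-neighbours off the path. Hence \<open>w\<^sub>1\<close> may be replaced by any other such vertex, so
  these vertices, of which there are at least \<open>m\<close>, are pairwise joined in both directions: too
  many out-neighbours.
\<close>

section \<open>Strong sets and double stars in a bare arc relation\<close>

definition strong_on :: "('a \<times> 'a) set \<Rightarrow> 'a set \<Rightarrow> bool" where
  "strong_on E X \<longleftrightarrow> X \<noteq> {} \<and> (\<forall>u\<in>X. \<forall>v\<in>X. (u, v) \<in> rtrancl_on X E)"

text \<open>The three disjuncts are the out-, in- and out-in-double-star, in this order. Only the
  vertex set is recorded, as it alone decides what remains after removal;
  \<open>subgraph_of_double_star\<close> rebuilds the subdigraph.\<close>

definition double_star :: "('a \<times> 'a) set \<Rightarrow> nat \<Rightarrow> nat \<Rightarrow> 'a set \<Rightarrow> bool" where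
  "double_star E r s M \<longleftrightarrow> (\<exists>u v X Y. M = {u, v} \<union> X \<union> Y \<and> u \<noteq> v \<and> (u, v) \<in> E
     \<and> finite X \<and> finite Y \<and> card X = r \<and> card Y = s \<and> X \<inter> Y = {} \<and> {u, v} \<inter> (X \<union> Y) = {}
     \<and> (X \<subseteq> E `` {u} \<and> Y \<subseteq> E `` {v} \<or> X \<subseteq> E\<inverse> `` {u} \<and> Y \<subseteq> E\<inverse> `` {v}
        \<or> X \<subseteq> E `` {u} \<and> Y \<subseteq> E\<inverse> `` {v}))"

lemma double_star_mono:
  assumes "double_star F r s M" "F \<inter> M \<times> M \<subseteq> E"
  shows "double_star E r s M"
proof -
  obtain u v X Y where M: "M = {u, v} \<union> X \<union> Y" "u \<noteq> v" "(u, v) \<in> F"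
      "finite X" "finite Y" "card X = r" "card Y = s" "X \<inter> Y = {}" "{u, v} \<inter> (X \<union> Y) = {}"
      and orient: "X \<subseteq> F `` {u} \<and> Y \<subseteq> F `` {v} \<or> X \<subseteq> F\<inverse> `` {u} \<and> Y \<subseteq> F\<inverse> `` {v}
        \<or> X \<subseteq> F `` {u} \<and> Y \<subseteq> F\<inverse> `` {v}"
    using assms(1) unfolding double_star_def by (elim exE conjE)
  have "X \<subseteq> F `` {u} \<Longrightarrow> X \<subseteq> E `` {u}" "Y \<subseteq> F `` {v} \<Longrightarrow> Y \<subseteq> E `` {v}"
      "X \<subseteq> F\<inverse> `` {u} \<Longrightarrow> X \<subseteq> E\<inverse> `` {u}" "Y \<subseteq> F\<inverse> `` {v} \<Longrightarrow> Y \<subseteq> E\<inverse> `` {v}"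
    using assms(2) M(1) by auto
  then have "X \<subseteq> E `` {u} \<and> Y \<subseteq> E `` {v} \<or> X \<subseteq> E\<inverse> `` {u} \<and> Y \<subseteq> E\<inverse> `` {v}
        \<or> X \<subseteq> E `` {u} \<and> Y \<subseteq> E\<inverse> `` {v}"
    using orient by argo
  moreover have "(u, v) \<in> E" using assms(2) M(1,3) by auto
  ultimately show ?thesis unfolding double_star_def using M by (intro exI conjI)
qed

lemma card_double_star:
  assumes "double_star E r s M"
  shows "finite M" "card M = r + s + 2"
proof -
  obtain u v X Y where M: "M = {u, v} \<union> X \<union> Y" "u \<noteq> v" "finite X" "finite Y" "card X = r"
      "card Y = s" "X \<inter> Y = {}" "{u, v} \<inter> (X \<union> Y) = {}"
    using assms unfolding double_star_def by blast
  have "M = insert u (insert v (X \<union> Y))" using M by auto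
  then show "finite M" "card M = r + s + 2"
    using M by (auto simp: card_insert_if card_Un_disjoint)
qed

lemma ex_in_of_card_pos: "0 < card X \<Longrightarrow> \<exists>x. x \<in> X"
  by (auto simp: card_gt_0_iff)

text \<open>Elements of \<open>X - Y\<close> cost \<open>Y'\<close> nothing, so \<open>X'\<close>
  uses them first. If they are too few, only the missing \<open>r - card (X - Y)\<close> elements
  come from the intersection, and \<open>card (X \<union> Y) - r\<close> elements of
  \<open>Y\<close> stay free.\<close>

lemma obtain_disjoint_subsets:
  assumes "finite X" "finite Y" "r \<le> card X" "s \<le> card Y" "r + s \<le> card (X \<union> Y)"
  obtains X' Y' where "X' \<subseteq> X" "Y' \<subseteq> Y" "X' \<inter> Y' = {}" "card X' = r" "card Y' = s"
proof (cases "r \<le> card (X - Y)")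
  case True
  then obtain X' where "X' \<subseteq> X - Y" "card X' = r" by (meson obtain_subset_with_card_n)
  moreover obtain Y' where "Y' \<subseteq> Y" "card Y' = s" using assms by (meson obtain_subset_with_card_n)
  ultimately show thesis by (intro that[of X' Y']) auto
next
  case False
  have "card X = card (X - Y) + card (X \<inter> Y)"
    using card_Int_Diff[OF assms(1), of Y] by simp
  then have "r - card (X - Y) \<le> card (X \<inter> Y)" using assms by linarith
  then obtain C where C: "C \<subseteq> X \<inter> Y" "card C = r - card (X - Y)"
    by (meson obtain_subset_with_card_n)
  have fin: "finite C" using C assms by (meson finite_Int finite_subset)
  have "card (X \<union> Y) = card (X - Y) + card Y"
    using assms by (metis Diff_disjoint Un_Diff_cancel2 card_Un_disjoint finite_Diff inf_commute)
  moreover have "card (Y - C) = card Y - card C"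
    using C fin by (intro card_Diff_subset) auto
  ultimately have "s \<le> card (Y - C)" using assms False C by linarith
  then obtain Y' where Y': "Y' \<subseteq> Y - C" "card Y' = s" by (meson obtain_subset_with_card_n)
  have "card ((X - Y) \<union> C) = r"
    using C fin assms False by (subst card_Un_disjoint) auto
  then show thesis using C Y' by (intro that[of "(X - Y) \<union> C" Y']) auto
qed

lemma double_star_at_arc:
  assumes "finite Q" "(u, v) \<in> E" "u \<noteq> v" "u \<in> Q" "v \<in> Q"
    and "X \<subseteq> Q - {u, v}" "Y \<subseteq> Q - {u, v}" "r \<le> card X" "s \<le> card Y" "r + s \<le> card (X \<union> Y)"
    and "X \<subseteq> E `` {u} \<and> Y \<subseteq> E `` {v} \<or> X \<subseteq> E\<inverse> `` {u} \<and> Y \<subseteq> E\<inverse> `` {v}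
        \<or> X \<subseteq> E `` {u} \<and> Y \<subseteq> E\<inverse> `` {v}"
  shows "\<exists>M\<subseteq>Q. double_star E r s M"
proof -
  have fin: "finite X" "finite Y" using assms by (auto intro: finite_subset)
  then obtain X' Y' where XY: "X' \<subseteq> X" "Y' \<subseteq> Y" "X' \<inter> Y' = {}" "card X' = r" "card Y' = s"
    using obtain_disjoint_subsets assms by metis
  have fin': "finite X'" "finite Y'" using XY fin by (auto intro: finite_subset)
  have "X' \<subseteq> E `` {u} \<and> Y' \<subseteq> E `` {v} \<or> X' \<subseteq> E\<inverse> `` {u} \<and> Y' \<subseteq> E\<inverse> `` {v}
        \<or> X' \<subseteq> E `` {u} \<and> Y' \<subseteq> E\<inverse> `` {v}"
    using assms(11) XY(1,2) by (meson subset_trans)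
  moreover have "{u, v} \<inter> (X' \<union> Y') = {}" using assms XY by blast
  ultimately have "double_star E r s ({u, v} \<union> X' \<union> Y')"
    unfolding double_star_def using XY fin' assms by blast
  moreover have "{u, v} \<union> X' \<union> Y' \<subseteq> Q" using assms XY by blast
  ultimately show ?thesis by blast
qed

text \<open>Deleting the opposite centre from each neighbourhood leaves at least
  \<open>r + s\<close> candidates on either side, enough for disjoint leaf sets.\<close>

lemma double_star_at_rich_arc:
  assumes "finite Q" "(u, v) \<in> E" "\<And>x. (x, x) \<notin> E" "u \<in> Q" "v \<in> Q"
    and "r + s < card (E `` {u} \<inter> Q) \<and> r + s < card (E `` {v} \<inter> Q)
      \<or> r + s < card (E\<inverse> `` {u} \<inter> Q) \<and> r + s < card (E\<inverse> `` {v} \<inter> Q)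
      \<or> r + s < card (E `` {u} \<inter> Q) \<and> r + s < card (E\<inverse> `` {v} \<inter> Q)"
  shows "\<exists>M\<subseteq>Q. double_star E r s M"
proof -
  have "u \<noteq> v" using assms by blast
  have star: "\<exists>M\<subseteq>Q. double_star E r s M"
    if "r + s < card X" "r + s < card Y" "X \<subseteq> Q" "Y \<subseteq> Q" "u \<notin> X" "v \<notin> Y"
      "X \<subseteq> E `` {u} \<and> Y \<subseteq> E `` {v} \<or> X \<subseteq> E\<inverse> `` {u} \<and> Y \<subseteq> E\<inverse> `` {v}
        \<or> X \<subseteq> E `` {u} \<and> Y \<subseteq> E\<inverse> `` {v}" for X Y
  proof (rule double_star_at_arc[OF \<open>finite Q\<close> \<open>(u, v) \<in> E\<close> \<open>u \<noteq> v\<close> \<open>u \<in> Q\<close> \<open>v \<in> Q\<close>])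
    have fin: "finite X" "finite Y" using that \<open>finite Q\<close> by (auto intro: finite_subset)
    have X: "r + s \<le> card (X - {v})" and Y: "r + s \<le> card (Y - {u})"
      using that fin by (auto simp: card_Diff_singleton_if)
    then show "r \<le> card (X - {v})" "s \<le> card (Y - {u})" by linarith+
    have "card (X - {v}) \<le> card ((X - {v}) \<union> (Y - {u}))"
      using fin by (intro card_mono) auto
    with X show "r + s \<le> card ((X - {v}) \<union> (Y - {u}))" by linarith
    show "X - {v} \<subseteq> Q - {u, v}" "Y - {u} \<subseteq> Q - {u, v}" using that by auto
    show "X - {v} \<subseteq> E `` {u} \<and> Y - {u} \<subseteq> E `` {v} \<or> X - {v} \<subseteq> E\<inverse> `` {u} \<and> Y - {u} \<subseteq> E\<inverse> `` {v}
        \<or> X - {v} \<subseteq> E `` {u} \<and> Y - {u} \<subseteq> E\<inverse> `` {v}"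
      using that(7) by (meson Diff_subset subset_trans)
  qed
  show ?thesis using assms(6)
  proof (elim disjE)
    assume "r + s < card (E `` {u} \<inter> Q) \<and> r + s < card (E `` {v} \<inter> Q)"
    then show ?thesis by (intro star[of "E `` {u} \<inter> Q" "E `` {v} \<inter> Q"]) (use assms(3) in auto)
  next
    assume "r + s < card (E\<inverse> `` {u} \<inter> Q) \<and> r + s < card (E\<inverse> `` {v} \<inter> Q)"
    then show ?thesis by (intro star[of "E\<inverse> `` {u} \<inter> Q" "E\<inverse> `` {v} \<inter> Q"]) (use assms(3) in auto)
  next
    assume "r + s < card (E `` {u} \<inter> Q) \<and> r + s < card (E\<inverse> `` {v} \<inter> Q)"
    then show ?thesis by (intro star[of "E `` {u} \<inter> Q" "E\<inverse> `` {v} \<inter> Q"]) (use assms(3) in auto)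
  qed
qed

section \<open>Entry and exit vertices outside a strong set\<close>

text \<open>An abstraction of \<open>R = V - H\<close>: \<open>F\<close> is the arc relation on
  \<open>R\<close>, and only the entry set \<open>A\<close> and the exit set \<open>B\<close>
  remember \<open>H\<close>. The degree bound \<open>r + s + 3\<close> is
  \<open>m + 1\<close>.\<close>

locale entry_exit =
  fixes R :: "'a set" and F :: "('a \<times> 'a) set" and A B :: "'a set" and r s :: nat
  assumes finite_R: "finite R" and F_subset: "F \<subseteq> R \<times> R" and irrefl: "(x, x) \<notin> F"
    and A_subset: "A \<subseteq> R" and B_subset: "B \<subseteq> R"
    and out_deg: "x \<in> R - B \<Longrightarrow> r + s + 3 \<le> card (F `` {x})"
    and in_deg: "x \<in> R - A \<Longrightarrow> r + s + 3 \<le> card (F\<inverse> `` {x})"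
    and r_pos: "1 \<le> r" and s_pos: "1 \<le> s"
begin

text \<open>\<open>n\<close> counts arcs, so \<open>n = 0\<close> gives a single vertex of
  \<open>A \<inter> B\<close>.\<close>

definition route :: "nat \<Rightarrow> (nat \<Rightarrow> 'a) \<Rightarrow> bool" where
  "route n w \<longleftrightarrow> w 0 \<in> A \<and> w n \<in> B \<and> (\<forall>i<n. (w i, w (Suc i)) \<in> F)"

lemma route_in_R:
  assumes "route n w" "i \<le> n" shows "w i \<in> R"
proof (cases "i = n")
  case True
  then show ?thesis using assms B_subset by (auto simp: route_def)
next
  case False
  then have "(w i, w (Suc i)) \<in> F" using assms by (simp add: route_def)
  then show ?thesis using F_subset by blast
qed

lemma finite_out: "finite (F `` {x})" and finite_in: "finite (F\<inverse> `` {x})"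
  using F_subset finite_R by (auto intro: finite_subset[of _ R])

lemma card_out_minus:
  assumes "x \<in> R - B" "F `` {x} \<inter> P \<subseteq> K" "finite K" "card K \<le> k"
  shows "r + s + 3 \<le> card (F `` {x} - P) + k"
proof -
  have "F `` {x} \<subseteq> (F `` {x} - P) \<union> K" using assms by blast
  then have "card (F `` {x}) \<le> card ((F `` {x} - P) \<union> K)"
    using assms finite_out by (intro card_mono) auto
  also have "\<dots> \<le> card (F `` {x} - P) + card K" by (rule card_Un_le)
  finally show ?thesis using out_deg[OF assms(1)] assms(4) by linarith
qed

lemma card_in_minus:
  assumes "x \<in> R - A" "F\<inverse> `` {x} \<inter> P \<subseteq> K" "finite K" "card K \<le> k"
  shows "r + s + 3 \<le> card (F\<inverse> `` {x} - P) + k"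
proof -
  have "F\<inverse> `` {x} \<subseteq> (F\<inverse> `` {x} - P) \<union> K" using assms by blast
  then have "card (F\<inverse> `` {x}) \<le> card ((F\<inverse> `` {x} - P) \<union> K)"
    using assms finite_in by (intro card_mono) auto
  also have "\<dots> \<le> card (F\<inverse> `` {x} - P) + card K" by (rule card_Un_le)
  finally show ?thesis using in_deg[OF assms(1)] assms(4) by linarith
qed

text \<open>A vertex outside \<open>A \<inter> B\<close> keeps its full out-degree or its full
  in-degree in \<open>R\<close>. The vertex \<open>x\<close> has too many neighbours for all of them
  to lie in \<open>(A \<inter> B) \<union> Y\<close>, so one of them also keeps a full degree, and
  the arc between the two is rich even after \<open>Y\<close> is removed.\<close>

lemma double_star_avoiding_few:
  assumes Y: "finite Y" "card Y \<le> 2" "card ((A \<inter> B) \<union> Y) \<le> r + s + 2"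
    and x: "x \<in> R - (A \<inter> B) - Y"
  shows "\<exists>M\<subseteq>R - Y. double_star F r s M"
proof -
  let ?Q = "R - Y"
  have out: "r + s < card (F `` {z} \<inter> ?Q)" if "z \<in> R - B" for z
  proof -
    have "F `` {z} \<inter> ?Q = F `` {z} - Y" using F_subset by auto
    then show ?thesis using card_out_minus[OF that, of Y Y 2] Y by simp
  qed
  have inn: "r + s < card (F\<inverse> `` {z} \<inter> ?Q)" if "z \<in> R - A" for z
  proof -
    have "F\<inverse> `` {z} \<inter> ?Q = F\<inverse> `` {z} - Y" using F_subset by auto
    then show ?thesis using card_in_minus[OF that, of Y Y 2] Y by simp
  qed
  have fin: "finite ((A \<inter> B) \<union> Y)" using Y A_subset finite_R by (auto intro: finite_subset)
  show ?thesis
  proof (cases "x \<in> B")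
    case False
    then have "\<not> F `` {x} \<subseteq> (A \<inter> B) \<union> Y"
      using out_deg[of x] x Y fin card_mono[OF fin, of "F `` {x}"] by fastforce
    then obtain y where y: "(x, y) \<in> F" "y \<notin> A \<inter> B" "y \<notin> Y" by blast
    then have yR: "y \<in> R" using F_subset by blast
    show ?thesis
      by (rule double_star_at_rich_arc[of _ x y])
        (use finite_R irrefl x y yR out inn False in auto)
  next
    case True
    then have xA: "x \<in> R - A" using x by blast
    \<comment> \<open>An in-neighbour is needed here: an arc leaving \<open>x\<close> might pair a
      large in-degree at its tail with a large out-degree at its head, which is none of the three
      kinds.\<close>
    then have "\<not> F\<inverse> `` {x} \<subseteq> (A \<inter> B) \<union> Y"
      using in_deg[of x] x Y fin card_mono[OF fin, of "F\<inverse> `` {x}"] by fastforce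
    then obtain y where y: "(y, x) \<in> F" "y \<notin> A \<inter> B" "y \<notin> Y" by blast
    then have yR: "y \<in> R" using F_subset by blast
    show ?thesis
      by (rule double_star_at_rich_arc[of _ y x])
        (use finite_R irrefl x y yR out inn xA in auto)
  qed
qed

end

section \<open>Shortest routes with at least three vertices\<close>

locale shortest_route = entry_exit +
  fixes n :: nat
  assumes disjoint: "A \<inter> B = {}" and n_ge: "2 \<le> n"
    and shortest: "a \<in> A \<Longrightarrow> b \<in> B \<Longrightarrow> (a, b) \<in> F ^^ j \<Longrightarrow> n \<le> j"
begin

lemma route_relpow_from:
  assumes "route n w" "i \<le> n" shows "(w 0, w i) \<in> F ^^ i"
  using assms unfolding relpow_fun_conv route_def by (intro exI[of _ w]) auto

lemma route_relpow_to:
  assumes "route n w" "i \<le> n" shows "(w i, w n) \<in> F ^^ (n - i)"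
  using assms unfolding relpow_fun_conv route_def by (intro exI[of _ "\<lambda>j. w (i + j)"]) auto

text \<open>Otherwise going from \<open>a\<close> via \<open>x\<close> to \<open>w j\<close> and on
  along the route would lead from \<open>A\<close> to \<open>B\<close> in fewer than
  \<open>n\<close> steps.\<close>

lemma arc_into_route:
  assumes "route n w" "a \<in> A" "(a, x) \<in> F ^^ k" "(x, w j) \<in> F" "j \<le> n"
  shows "j \<le> Suc k"
proof -
  have "(a, w j) \<in> F ^^ Suc k" using assms by auto
  then have "(a, w n) \<in> F ^^ (Suc k + (n - j))"
    using route_relpow_to[OF assms(1,5)] by (metis relcompI relpow_add)
  moreover have "w n \<in> B" using assms by (simp add: route_def)
  ultimately have "n \<le> Suc k + (n - j)" using shortest assms(2) by blast
  then show ?thesis using assms by linarith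
qed

lemma arc_from_route:
  assumes "route n w" "x \<in> B" "(w j, x) \<in> F" "j \<le> n"
  shows "n \<le> Suc j"
proof -
  have "(w 0, x) \<in> F ^^ Suc j" using route_relpow_from[OF assms(1,4)] assms(3) by auto
  moreover have "w 0 \<in> A" using assms by (simp add: route_def)
  ultimately show ?thesis using shortest assms(2) by blast
qed

lemma route_inj:
  assumes "route n w" shows "inj_on w {..n}"
proof (rule linorder_inj_onI')
  fix i j assume ij: "i \<in> {..n}" "j \<in> {..n}" "i < j"
  show "w i \<noteq> w j"
  proof
    assume "w i = w j"
    then have "(w 0, w n) \<in> F ^^ (i + (n - j))"
      using route_relpow_from[OF assms, of i] route_relpow_to[OF assms, of j] ij
      by (metis atMost_iff relcompI relpow_add)
    then have "n \<le> i + (n - j)" using shortest assms by (auto simp: route_def)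
    then show False using ij by auto
  qed
qed

text \<open>All routes of the shortest length are considered at once: the proof may reroute.\<close>

context
  assumes no_star: "\<And>w M. route n w \<Longrightarrow> M \<subseteq> R - w ` {..n} \<Longrightarrow> \<not> double_star F r s M"
begin

text \<open>One step from \<open>w 0\<close>, the vertex \<open>c\<close> has arcs to at most three
  route vertices, so at least \<open>r + s\<close> out-neighbours \<open>d\<close> lie off the
  route. A surplus would force \<open>r = 1\<close> and four arcs from each such \<open>d\<close>
  into the route; rerouting through \<open>c\<close> and one \<open>d\<close> then exposes an
  in-double-star at \<open>(w 1, w 2)\<close>.\<close>

lemma out_of_second_layer:
  assumes w: "route n w" and c: "c \<in> F `` {w 0} - w ` {..n}"
  shows "card (F `` {c} - w ` {..n}) = r + s" "{w 0, w 1, w 2} \<subseteq> F `` {c}"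
proof -
  let ?P = "w ` {..n}"
  let ?N = "\<lambda>x. F `` {x} - ?P"
  have w0: "w 0 \<in> A" using w by (simp add: route_def)
  have relc: "(w 0, c) \<in> F ^^ 1" using c by auto
  have cR: "c \<in> R" using c F_subset by auto
  have cB: "c \<in> R - B" using shortest[OF w0 _ relc] cR n_ge by auto
  have c_out: "F `` {c} \<inter> ?P \<subseteq> {w 0, w 1, w 2}"
  proof
    fix x assume "x \<in> F `` {c} \<inter> ?P"
    then obtain j where j: "x = w j" "j \<le> n" "(c, w j) \<in> F" by auto
    then have "j \<le> Suc 1" using arc_into_route[OF w w0 relc] by blast
    then have "j = 0 \<or> j = 1 \<or> j = 2" by linarith
    then show "x \<in> {w 0, w 1, w 2}" using j by auto
  qed
  have Nc: "r + s \<le> card (?N c)"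
    using card_out_minus[OF cB c_out, of 3] by (simp add: card_insert_if)
  have finQ: "finite (R - ?P)" using finite_R by simp
  \<comment> \<open>Each such \<open>d\<close> is two steps from \<open>w 0\<close>. For
    \<open>n = 2\<close> the index 3 lies beyond the end of the route, but the set is still a valid
    upper bound.\<close>
  have dfacts: "d \<in> R - B \<and> F `` {d} \<inter> ?P \<subseteq> {w 0, w 1, w 2, w 3} \<and> d \<noteq> c" if d: "d \<in> ?N c" for d
  proof (intro conjI)
    have dR: "d \<in> R" using d F_subset by auto
    show dc: "d \<noteq> c" using d irrefl by auto
    have "d \<notin> B"
    proof
      assume dB: "d \<in> B"
      \<comment> \<open>An exit vertex off the route receives arcs only from the last two route
        vertices, so its in-degree stays large and \<open>(c, d)\<close> carries an
        out-in-double-star.\<close>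
      have "F\<inverse> `` {d} \<inter> ?P \<subseteq> {w (n - 1), w n}"
      proof
        fix x assume "x \<in> F\<inverse> `` {d} \<inter> ?P"
        then obtain j where j: "x = w j" "j \<le> n" "(w j, d) \<in> F" by auto
        then have "j = n - 1 \<or> j = n" using arc_from_route[OF w dB] by force
        then show "x \<in> {w (n - 1), w n}" using j by auto
      qed
      moreover have "d \<in> R - A" using dB disjoint dR by blast
      ultimately have Nd: "r + s + 1 \<le> card (F\<inverse> `` {d} - ?P)"
        using card_in_minus[of d ?P "{w (n - 1), w n}" 2] by (simp add: card_insert_if)
      have "\<exists>M\<subseteq>R - ?P. double_star F r s M"
      proof (rule double_star_at_arc[of _ c d _ "?N c - {d}" "F\<inverse> `` {d} - ?P - {c}"])
        have "r + s \<le> card (F\<inverse> `` {d} - ?P - {c})"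
          using Nd finite_in[of d] by (auto simp: card_Diff_singleton_if)
        moreover have "card (F\<inverse> `` {d} - ?P - {c}) \<le> card ((?N c - {d}) \<union> (F\<inverse> `` {d} - ?P - {c}))"
          using finite_in finite_out by (intro card_mono) auto
        ultimately show "s \<le> card (F\<inverse> `` {d} - ?P - {c})"
          "r + s \<le> card ((?N c - {d}) \<union> (F\<inverse> `` {d} - ?P - {c}))" by linarith+
        \<comment> \<open>Removing \<open>d\<close> may leave only \<open>r + s - 1\<close>
          vertices, which is at least \<open>r\<close> because \<open>s\<close> is positive.\<close>
        show "r \<le> card (?N c - {d})"
          using Nc finite_out[of c] s_pos by (auto simp: card_Diff_singleton_if)
      qed (use finQ d c cR dR dc irrefl F_subset in auto)
      then show False using no_star[OF w] by blast
    qed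
    then show "d \<in> R - B" using dR by simp
    have rel: "(w 0, d) \<in> F ^^ 2" using relc d by (auto simp: numeral_2_eq_2)
    show "F `` {d} \<inter> ?P \<subseteq> {w 0, w 1, w 2, w 3}"
    proof
      fix x assume "x \<in> F `` {d} \<inter> ?P"
      then obtain j where j: "x = w j" "j \<le> n" "(d, w j) \<in> F" by auto
      then have "j \<le> Suc 2" using arc_into_route[OF w w0 rel] by blast
      then have "j = 0 \<or> j = 1 \<or> j = 2 \<or> j = 3" by linarith
      then show "x \<in> {w 0, w 1, w 2, w 3}" using j by auto
    qed
  qed
  have Nd: "r + s \<le> card (?N d) + 1" if "d \<in> ?N c" for d
    using card_out_minus[of d ?P "{w 0, w 1, w 2, w 3}" 4] dfacts[OF that]
    by (simp add: card_insert_if)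
  show eq: "card (?N c) = r + s"
  proof (rule ccontr)
    assume "card (?N c) \<noteq> r + s"
    then have Nc1: "r + s + 1 \<le> card (?N c)" using Nc by simp
    \<comment> \<open>By the surplus, \<open>?N c - {d}\<close> alone has \<open>r + s\<close>
      vertices, so only a lack of leaves at \<open>d\<close> can prevent an out-double-star at
      \<open>(c, d)\<close>.\<close>
    have small: "card (?N d - {c}) < s" if d: "d \<in> ?N c" for d
    proof (rule ccontr)
      assume "\<not> card (?N d - {c}) < s"
      have "\<exists>M\<subseteq>R - ?P. double_star F r s M"
      proof (rule double_star_at_arc[of _ c d _ "?N c - {d}" "?N d - {c}"])
        have "r + s \<le> card (?N c - {d})"
          using Nc1 finite_out[of c] by (auto simp: card_Diff_singleton_if)
        moreover have "card (?N c - {d}) \<le> card ((?N c - {d}) \<union> (?N d - {c}))"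
          using finite_out by (intro card_mono) auto
        ultimately show "r \<le> card (?N c - {d})" "r + s \<le> card ((?N c - {d}) \<union> (?N d - {c}))"
          by linarith+
        show "s \<le> card (?N d - {c})" using \<open>\<not> card (?N d - {c}) < s\<close> by simp
      qed (use finQ d c cR dfacts[OF d] irrefl F_subset in auto)
      then show False using no_star[OF w] by blast
    qed
    have d_out: "{w 0, w 1, w 2, w 3} \<subseteq> F `` {d} \<and> r = 1" if d: "d \<in> ?N c" for d
    proof -
      \<comment> \<open>Together with \<open>Nd\<close> this gives
        \<open>r + s - 1 \<le> card (?N d) \<le> s\<close>: hence \<open>r = 1\<close>, and
        \<open>d\<close> must lose four out-neighbours to the route.\<close>
      have sm: "card (?N d) \<le> s"
        using small[OF d] finite_out[of d] by (auto simp: card_Diff_singleton_if split: if_splits)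
      then have r1: "r = 1" using Nd[OF d] r_pos by linarith
      have K: "F `` {d} \<inter> ?P \<subseteq> {w 0, w 1, w 2, w 3}" using dfacts[OF d] by simp
      have "{w 0, w 1, w 2, w 3} \<subseteq> F `` {d} \<inter> ?P"
      proof (rule ccontr)
        assume "\<not> ?thesis"
        then have "F `` {d} \<inter> ?P \<subset> {w 0, w 1, w 2, w 3}" using K by blast
        then have "card (F `` {d} \<inter> ?P) < card {w 0, w 1, w 2, w 3}"
          by (intro psubset_card_mono) auto
        also have "\<dots> \<le> 4" by (simp add: card_insert_if)
        finally have "card (F `` {d} \<inter> ?P) \<le> 3" by simp
        then have "r + s \<le> card (?N d)"
          using card_out_minus[of d ?P "F `` {d} \<inter> ?P" 3] dfacts[OF d] by auto
        then show False using sm r1 by simp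
      qed
      then show ?thesis using r1 by auto
    qed
    have "0 < card (?N c)" using Nc1 by linarith
    then obtain d where d: "d \<in> ?N c" using ex_in_of_card_pos by blast
    have r1: "r = 1" using d_out[OF d] by simp
    have n3: "3 \<le> n"
    proof (rule ccontr)
      assume "\<not> 3 \<le> n"
      txt \<open>Then \<open>d\<close> would send four arcs into a route with only three vertices.\<close>
      then have n2: "n = 2" using n_ge by simp
      have "?P = {w 0, w 1, w 2}" unfolding n2 by (auto simp: atMost_Suc numeral_2_eq_2)
      then have "r + s \<le> card (?N d)"
        using card_out_minus[of d ?P ?P 3] dfacts[OF d] by (auto simp: card_insert_if)
      moreover have "card (?N d) \<le> s"
        using small[OF d] finite_out[of d] by (auto simp: card_Diff_singleton_if split: if_splits)
      ultimately show False using r1 by simp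
    qed
    txt \<open>Rerouting through \<open>c\<close> and \<open>d\<close> frees the arc from \<open>w 1\<close> to \<open>w 2\<close>, into which all
      other out-neighbours of \<open>c\<close> point.\<close>
    define w' where "w' = w(1 := c, 2 := d)"
    have w'r: "route n w'"
      unfolding route_def
    proof (intro conjI allI impI)
      show "w' 0 \<in> A" "w' n \<in> B" using w n3 by (auto simp: route_def w'_def)
      fix i assume "i < n"
      then have "(w i, w (Suc i)) \<in> F" using w by (simp add: route_def)
      then show "(w' i, w' (Suc i)) \<in> F"
        using c d d_out[OF d] by (auto simp: w'_def numeral_2_eq_2 numeral_3_eq_3)
    qed
    have inj: "w i \<noteq> w j" if "i \<le> n" "j \<le> n" "i \<noteq> j" for i j
      using route_inj[OF w] that by (auto simp: inj_on_def)
    have P': "w' ` {..n} \<subseteq> ?P - {w 1, w 2} \<union> {c, d}"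
    proof
      fix x assume "x \<in> w' ` {..n}"
      then obtain i where i: "i \<le> n" "x = w' i" by auto
      consider "i = 1" | "i = 2" | "i \<noteq> 1" "i \<noteq> 2" by blast
      then show "x \<in> ?P - {w 1, w 2} \<union> {c, d}"
        using i inj[of i 1] inj[of i 2] n3 by cases (auto simp: w'_def)
    qed
    \<comment> \<open>For \<open>r = 1\<close> the surplus means at least \<open>s + 2\<close>
      vertices in \<open>?N c\<close>: one is \<open>d\<close> on the new route, one is the single
      leaf \<open>e\<close> at \<open>w 1\<close>, and at least \<open>s\<close> remain as leaves at
      \<open>w 2\<close>.\<close>
    have "s + 1 \<le> card (?N c - {d})"
      using Nc1 r1 finite_out[of c] d by (auto simp: card_Diff_singleton_if)
    then have "0 < card (?N c - {d})" by linarith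
    then obtain e where e: "e \<in> ?N c - {d}" using ex_in_of_card_pos by blast
    have Nce: "s \<le> card (?N c - {d} - {e})"
      using \<open>s + 1 \<le> card (?N c - {d})\<close> e finite_out[of c] by (auto simp: card_Diff_singleton_if)
    have w12: "w 1 \<in> ?P" "w 2 \<in> ?P" "w 1 \<noteq> w 2" "(w 1, w 2) \<in> F"
      using n3 inj[of 1 2] w by (auto simp: route_def numeral_2_eq_2)
    have sub: "?N c - {d} \<subseteq> R - w' ` {..n} - {w 1, w 2}"
      using P' F_subset irrefl w12 by auto
    have w12Q: "w 1 \<in> R - w' ` {..n}" "w 2 \<in> R - w' ` {..n}"
    proof -
      have "w 1 \<notin> w' ` {..n}" "w 2 \<notin> w' ` {..n}" using w12(1,2) P' c d by blast+
      then show "w 1 \<in> R - w' ` {..n}" "w 2 \<in> R - w' ` {..n}"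
        using route_in_R[OF w, of 1] route_in_R[OF w, of 2] n3 by auto
    qed
    have "\<exists>M\<subseteq>R - w' ` {..n}. double_star F r s M"
    proof (rule double_star_at_arc[of _ "w 1" "w 2" _ "{e}" "?N c - {d} - {e}"])
      have "card ({e} \<union> (?N c - {d} - {e})) = Suc (card (?N c - {d} - {e}))"
        using finite_out[of c] by (subst card_Un_disjoint) auto
      then show "r + s \<le> card ({e} \<union> (?N c - {d} - {e}))" using Nce r1 by simp
      have "{e} \<subseteq> F\<inverse> `` {w 1} \<and> ?N c - {d} - {e} \<subseteq> F\<inverse> `` {w 2}"
        using d_out e by blast
      then show "{e} \<subseteq> F `` {w 1} \<and> ?N c - {d} - {e} \<subseteq> F `` {w 2}
        \<or> {e} \<subseteq> F\<inverse> `` {w 1} \<and> ?N c - {d} - {e} \<subseteq> F\<inverse> `` {w 2}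
        \<or> {e} \<subseteq> F `` {w 1} \<and> ?N c - {d} - {e} \<subseteq> F\<inverse> `` {w 2}" by blast
      show "{e} \<subseteq> R - w' ` {..n} - {w 1, w 2}" using e sub by blast
      show "?N c - {d} - {e} \<subseteq> R - w' ` {..n} - {w 1, w 2}" using sub by blast
    qed (use finite_R w12 w12Q Nce r1 in simp_all)
    then show False using no_star[OF w'r] by blast
  qed
  show "{w 0, w 1, w 2} \<subseteq> F `` {c}"
  proof (rule ccontr)
    assume "\<not> ?thesis"
    \<comment> \<open>With exactly \<open>r + s\<close> out-neighbours off the route, out-degree
      \<open>r + s + 3\<close> leaves three arcs to be absorbed by the route.\<close>
    then have "F `` {c} \<inter> ?P \<subset> {w 0, w 1, w 2}" using c_out by blast
    then have "card (F `` {c} \<inter> ?P) < card {w 0, w 1, w 2}"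
      by (intro psubset_card_mono) auto
    also have "\<dots> \<le> 3" by (simp add: card_insert_if)
    finally have "card (F `` {c} \<inter> ?P) \<le> 2" by simp
    then have "r + s + 1 \<le> card (?N c)"
      using card_out_minus[OF cB, of ?P "F `` {c} \<inter> ?P" 2] finite_out by auto
    then show False using eq by simp
  qed
qed

lemma no_route: "\<not> route n w"
proof
  assume w: "route n w"
  let ?P = "w ` {..n}"
  let ?S = "F `` {w 0} - ?P"
  have w0: "w 0 \<in> A" using w by (simp add: route_def)
  have "F `` {w 0} \<inter> ?P \<subseteq> {w 1}"
  proof
    fix x assume "x \<in> F `` {w 0} \<inter> ?P"
    then obtain j where j: "x = w j" "j \<le> n" "(w 0, w j) \<in> F" by auto
    then have "j \<le> 1" using arc_into_route[OF w w0, of "w 0" 0 j] by auto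
    moreover have "j \<noteq> 0" using j irrefl by metis
    ultimately have "j = 1" by simp
    then show "x \<in> {w 1}" using j by simp
  qed
  moreover have "w 0 \<in> R - B" using w0 disjoint A_subset by blast
  ultimately have S: "r + s + 2 \<le> card ?S"
    using card_out_minus[of "w 0" ?P "{w 1}" 1] by simp
  then have "0 < card ?S" by linarith
  then obtain c where c: "c \<in> ?S" using ex_in_of_card_pos by blast
  have "?S - {c} \<subseteq> F `` {c} - ?P"
  proof
    fix c' assume c': "c' \<in> ?S - {c}"
    \<comment> \<open>The arc from \<open>c'\<close> to \<open>w 2\<close> makes this a route, and
      \<open>c\<close> is off it as well. The previous lemma, applied to the new route, yields the
      arc from \<open>c\<close> to its second vertex \<open>c'\<close>.\<close>
    define w' where "w' = w(1 := c')"
    have "(c', w 2) \<in> F" using out_of_second_layer(2)[OF w, of c'] c' by auto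
    then have w'r: "route n w'"
      using w c' n_ge unfolding route_def w'_def by (auto simp: numeral_2_eq_2)
    have "w' ` {..n} \<subseteq> ?P \<union> {c'}" by (auto simp: w'_def)
    then have "c \<in> F `` {w' 0} - w' ` {..n}" using c c' by (auto simp: w'_def)
    then have "w' 1 \<in> F `` {c}" using out_of_second_layer(2)[OF w'r] by blast
    then show "c' \<in> F `` {c} - ?P" using c' by (simp add: w'_def)
  qed
  \<comment> \<open>Now \<open>c\<close> has at least \<open>r + s + 1\<close> out-neighbours off
    the route, against the exact count \<open>r + s\<close>.\<close>
  then have "card (?S - {c}) \<le> card (F `` {c} - ?P)"
    using finite_out by (intro card_mono) auto
  moreover have "card (?S - {c}) = card ?S - 1" using c finite_out by (simp add: card_Diff_singleton)
  ultimately show False using S out_of_second_layer(1)[OF w c] by simp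
qed

end

end

section \<open>A route that leaves a double star intact\<close>

context entry_exit
begin

text \<open>If \<open>A\<close> and \<open>B\<close> meet, one vertex is a route: one outside
  \<open>M\<close> spares \<open>M\<close>, and if there is none, \<open>A \<inter> B\<close> has at
  most \<open>card M\<close> vertices and \<open>double_star_avoiding_few\<close> finds another
  star. Otherwise a shortest route is taken; with two vertices the same lemma applies.\<close>

lemma route_avoiding_double_star:
  assumes conn: "a \<in> A" "b \<in> B" "(a, b) \<in> F\<^sup>*"
    and M: "double_star F r s M" "M \<subset> R"
  shows "\<exists>n w. route n w \<and> (\<exists>M\<subseteq>R - w ` {..n}. double_star F r s M)"
proof (cases "A \<inter> B = {}")
  case False
  show ?thesis
  proof (cases "A \<inter> B \<subseteq> M")
    case True
    obtain z where z: "z \<in> A \<inter> B" using False by blast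
    obtain x where x: "x \<in> R - M" using M by blast
    have "card ((A \<inter> B) \<union> {z}) \<le> card M"
      using True z card_double_star[OF M(1)] by (intro card_mono) auto
    then have "\<exists>M\<subseteq>R - {z}. double_star F r s M"
      using card_double_star[OF M(1)] x z True by (intro double_star_avoiding_few[of _ x]) auto
    then show ?thesis using z by (intro exI[of _ 0] exI[of _ "\<lambda>_. z"]) (auto simp: route_def)
  next
    case False
    then obtain z where "z \<in> A \<inter> B" "z \<notin> M" by blast
    then show ?thesis using M
      by (intro exI[of _ 0] exI[of _ "\<lambda>_. z"]) (auto simp: route_def)
  qed
next
  case disj: True
  let ?reach = "\<lambda>n. \<exists>a\<in>A. \<exists>b\<in>B. (a, b) \<in> F ^^ n"
  define n where "n = (LEAST n. ?reach n)"
  have "\<exists>n. ?reach n" using conn by (meson rtrancl_power)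
  then have "?reach n" unfolding n_def by (rule LeastI_ex)
  then obtain w where w: "route n w" unfolding relpow_fun_conv route_def by blast
  have least: "n \<le> j" if "a \<in> A" "b \<in> B" "(a, b) \<in> F ^^ j" for a b j
    unfolding n_def using that by (intro Least_le) blast
  have n0: "n \<noteq> 0" using w disj by (auto simp: route_def)
  show ?thesis
  proof (cases "n = 1")
    case True
    have P: "w ` {..n} = {w 0, w 1}" using True by (auto simp: atMost_Suc)
    have "w 0 \<in> R - B" using w disj A_subset by (auto simp: route_def)
    then have "r + s + 3 \<le> card (F `` {w 0} - {w 0, w 1}) + 2"
      by (intro card_out_minus[of _ _ "{w 0, w 1}"]) (auto simp: card_insert_if)
    then have "0 < card (F `` {w 0} - {w 0, w 1})" by linarith
    then obtain x where "x \<in> F `` {w 0} - {w 0, w 1}" using ex_in_of_card_pos by blast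
    then have "\<exists>M\<subseteq>R - {w 0, w 1}. double_star F r s M"
      using disj F_subset r_pos s_pos
      by (intro double_star_avoiding_few[of _ x]) (auto simp: card_insert_if)
    then show ?thesis using w P by metis
  next
    case False
    then interpret shortest_route R F A B r s n
      using disj n0 least by unfold_locales auto
    \<comment> \<open>Outside its context \<open>no_route\<close> carries \<open>no_star\<close> as
      a premise. Since \<open>w\<close> is a route, that premise fails, so some shortest route
      avoids a double star.\<close>
    show ?thesis using no_route w by blast
  qed
qed

end

section \<open>Ears of strong sets\<close>

lemma rtrancl_on_mono_set: "(x, y) \<in> rtrancl_on X E \<Longrightarrow> X \<subseteq> Y \<Longrightarrow> (x, y) \<in> rtrancl_on Y E"
  by (induction rule: rtrancl_on.induct) (auto intro: rtrancl_on_into_rtrancl_on)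

text \<open>In the union every vertex is reachable from \<open>h\<close> and reaches
  \<open>h'\<close>, and \<open>h'\<close> reaches \<open>h\<close> inside \<open>H\<close>.\<close>

lemma strong_on_add_ear:
  assumes H: "strong_on E H" and h: "h \<in> H" "h' \<in> H" "(h, w 0) \<in> E" "(w n, h') \<in> E"
    and w: "\<And>i. i < n \<Longrightarrow> (w i, w (Suc i)) \<in> E"
  shows "strong_on E (H \<union> w ` {..n})"
proof -
  let ?X = "H \<union> w ` {..n}"
  have HX: "(x, y) \<in> rtrancl_on ?X E" if "x \<in> H" "y \<in> H" for x y
    using H that by (auto simp: strong_on_def intro: rtrancl_on_mono_set)
  have to_w: "(h, w i) \<in> rtrancl_on ?X E" if "i \<le> n" for i
    using that
  proof (induction i)
    case 0
    have "h \<in> ?X" "w 0 \<in> ?X" using h by auto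
    then show ?case using h(3) by (meson rtrancl_on_refl rtrancl_on_into_rtrancl_on)
  next
    case (Suc i)
    then have "(h, w i) \<in> rtrancl_on ?X E" "(w i, w (Suc i)) \<in> E" "w (Suc i) \<in> ?X"
      using w by auto
    then show ?case by (rule rtrancl_on_into_rtrancl_on)
  qed
  have from_w: "(w i, h') \<in> rtrancl_on ?X E" if "i \<le> n" for i
    using that
  proof (induction i rule: inc_induct)
    case base
    have "h' \<in> ?X" "w n \<in> ?X" using h by auto
    then show ?case using h(4) by (meson rtrancl_on_refl converse_rtrancl_on_into_rtrancl_on)
  next
    case (step i)
    then have "(w i, w (Suc i)) \<in> E" "(w (Suc i), h') \<in> rtrancl_on ?X E" "w i \<in> ?X"
      using w by auto
    then show ?case by (rule converse_rtrancl_on_into_rtrancl_on)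
  qed
  have to: "(h, x) \<in> rtrancl_on ?X E" and "from": "(x, h') \<in> rtrancl_on ?X E" if "x \<in> ?X" for x
    using that HX h to_w from_w by auto
  have "(x, y) \<in> rtrancl_on ?X E" if "x \<in> ?X" "y \<in> ?X" for x y
    using rtrancl_on_trans[OF "from"[OF that(1)] rtrancl_on_trans[OF HX[OF h(2,1)] to[OF that(2)]]] .
  then show ?thesis using h by (auto simp: strong_on_def)
qed

text \<open>Fix \<open>x\<close> in \<open>R\<close>. After its last visit to \<open>H\<close>, a
  walk from \<open>h\<close> to \<open>x\<close> enters \<open>R\<close> at some \<open>a\<close>
  and stays there; dually a walk from \<open>x\<close> to \<open>h\<close> first leaves
  \<open>R\<close> at some \<open>b\<close>. The two pieces join at \<open>x\<close>.\<close>

lemma strong_on_obtain_ear: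
  assumes V: "strong_on E V" and H: "H \<subseteq> V" "H \<noteq> {}" and R: "R = V - H" "R \<noteq> {}"
  obtains a b where "a \<in> {x \<in> R. \<exists>h\<in>H. (h, x) \<in> E}" "b \<in> {x \<in> R. \<exists>h\<in>H. (x, h) \<in> E}"
    "(a, b) \<in> (E \<inter> R \<times> R)\<^sup>*"
proof -
  obtain h x where hx: "h \<in> H" "x \<in> R" using assms by blast
  then have "(h, x) \<in> rtrancl_on V E" "(x, h) \<in> rtrancl_on V E"
    using assms by (auto simp: strong_on_def)
  \<comment> \<open>The first disjunct makes this an invariant along the whole walk, which may
    return to \<open>H\<close> several times.\<close>
  have "x \<in> H \<or> (\<exists>a\<in>{x \<in> R. \<exists>h\<in>H. (h, x) \<in> E}. (a, x) \<in> (E \<inter> R \<times> R)\<^sup>*)"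
    using \<open>(h, x) \<in> rtrancl_on V E\<close>
  proof (induction rule: rtrancl_on_induct)
    case base
    then show ?case using hx by simp
  next
    case (step y z)
    consider "z \<in> H" | "z \<in> R" "y \<in> H" | "z \<in> R" "y \<in> R" using step R by blast
    then show ?case
    proof cases
      case 2
      then show ?thesis using step by blast
    next
      case 3
      then obtain a where "a \<in> {x \<in> R. \<exists>h\<in>H. (h, x) \<in> E}" "(a, y) \<in> (E \<inter> R \<times> R)\<^sup>*"
        using step R by blast
      then show ?thesis using 3 step by (auto intro: rtrancl_into_rtrancl)
    qed simp
  qed
  then obtain a where a: "a \<in> {x \<in> R. \<exists>h\<in>H. (h, x) \<in> E}" "(a, x) \<in> (E \<inter> R \<times> R)\<^sup>*"
    using hx R by blast
  have "x \<in> H \<or> (\<exists>b\<in>{x \<in> R. \<exists>h\<in>H. (x, h) \<in> E}. (x, b) \<in> (E \<inter> R \<times> R)\<^sup>*)"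
    using \<open>(x, h) \<in> rtrancl_on V E\<close>
  proof (induction rule: converse_rtrancl_on_induct)
    case base
    then show ?case using hx by simp
  next
    case (step z y)
    consider "z \<in> H" | "z \<in> R" "y \<in> H" | "z \<in> R" "y \<in> R" using step R by blast
    then show ?case
    proof cases
      case 2
      then show ?thesis using step by blast
    next
      case 3
      then obtain b where "b \<in> {x \<in> R. \<exists>h\<in>H. (x, h) \<in> E}" "(y, b) \<in> (E \<inter> R \<times> R)\<^sup>*"
        using step R by blast
      then show ?thesis using 3 step by (auto intro: converse_rtrancl_into_rtrancl)
    qed simp
  qed
  then obtain b where "b \<in> {x \<in> R. \<exists>h\<in>H. (x, h) \<in> E}" "(x, b) \<in> (E \<inter> R \<times> R)\<^sup>*"
    using hx R by blast
  with a show thesis using that rtrancl_trans[OF a(2)] by blast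
qed

section \<open>Extending a maximal strong set\<close>

theorem strong_on_double_star_removal:
  assumes fin: "finite V" and E: "E \<subseteq> V \<times> V" and irrefl: "\<And>x. (x, x) \<notin> E"
    and strong: "strong_on E V" and rs: "1 \<le> r" "1 \<le> s"
    and out: "\<And>x. x \<in> V \<Longrightarrow> r + s + 3 \<le> card (E `` {x})"
    and inn: "\<And>x. x \<in> V \<Longrightarrow> r + s + 3 \<le> card (E\<inverse> `` {x})"
  shows "\<exists>M\<subseteq>V. double_star E r s M \<and> strong_on E (V - M)"
proof -
  define good where "good H \<longleftrightarrow> H \<subseteq> V \<and> strong_on E H \<and> (\<exists>M\<subseteq>V - H. double_star E r s M)" for H
  obtain h where h: "h \<in> V" using strong by (auto simp: strong_on_def)
  \<comment> \<open>This starts the maximality argument: a singleton is strong, and deleting it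
    costs every degree at most one.\<close>
  have "\<exists>M\<subseteq>V - {h}. double_star E r s M"
  proof -
    have deg: "r + s < card (E `` {x} \<inter> (V - {h}))" if "x \<in> V" for x
    proof -
      have "E `` {x} \<inter> (V - {h}) = E `` {x} - {h}" using E by auto
      moreover have "card (E `` {x}) - 1 \<le> card (E `` {x} - {h})" by (simp add: card_Diff_singleton_if)
      ultimately show ?thesis using out[OF that] by simp
    qed
    have "E `` {h} \<noteq> {}" using out[OF h] by auto
    then obtain u where u: "u \<in> V" "u \<noteq> h" using E irrefl by auto
    have "E `` {u} \<inter> (V - {h}) \<noteq> {}" using deg[OF u(1)] by auto
    then obtain v where v: "(u, v) \<in> E" "v \<in> V - {h}" by auto
    show ?thesis
      using fin irrefl u v deg by (intro double_star_at_rich_arc[of _ u v]) auto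
  qed
  then have "good {h}" using h by (auto simp: good_def strong_on_def)
  moreover have "finite {H. good H}" using fin by (auto simp: good_def intro: finite_subset[of _ "Pow V"])
  ultimately obtain H where H: "good H" and maximal: "\<And>H'. good H' \<Longrightarrow> H \<subseteq> H' \<Longrightarrow> H = H'"
    using finite_has_maximal[of "{H. good H}"] by blast
  define R where "R = V - H"
  define F where "F = E \<inter> R \<times> R"
  define A where "A = {x \<in> R. \<exists>h\<in>H. (h, x) \<in> E}"
  define B where "B = {x \<in> R. \<exists>h\<in>H. (x, h) \<in> E}"
  obtain M where M: "M \<subseteq> R" "double_star E r s M" using H by (auto simp: good_def R_def)
  have MF: "double_star F r s M"
    using M(1) by (intro double_star_mono[OF M(2)]) (auto simp: F_def)
  have "M = R"
  \<comment> \<open>If \<open>M\<close> misses a vertex of \<open>R\<close>, a route avoiding some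
    double star is an ear that enlarges \<open>H\<close>.\<close>
  proof (rule ccontr)
    assume "M \<noteq> R"
    interpret entry_exit R F A B r s
    proof
      show "finite R" "F \<subseteq> R \<times> R" "A \<subseteq> R" "B \<subseteq> R" "1 \<le> r" "1 \<le> s"
        using fin rs by (auto simp: R_def F_def A_def B_def)
      show "(x, x) \<notin> F" for x using irrefl by (auto simp: F_def)
      show "r + s + 3 \<le> card (F `` {x})" if "x \<in> R - B" for x
      proof -
        \<comment> \<open>A vertex of \<open>R\<close> outside \<open>B\<close> sends no arc into
          \<open>H\<close>.\<close>
        have "F `` {x} = E `` {x}" using that E by (auto simp: F_def B_def R_def)
        then show ?thesis using out that by (auto simp: R_def)
      qed
      show "r + s + 3 \<le> card (F\<inverse> `` {x})" if "x \<in> R - A" for x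
      proof -
        have "F\<inverse> `` {x} = E\<inverse> `` {x}" using that E by (auto simp: F_def A_def R_def)
        then show ?thesis using inn that by (auto simp: R_def)
      qed
    qed
    have "R \<noteq> {}" using M \<open>M \<noteq> R\<close> by blast
    have "H \<subseteq> V" "H \<noteq> {}" "strong_on E H" using H by (auto simp: good_def strong_on_def)
    obtain a b where "a \<in> A" "b \<in> B" "(a, b) \<in> F\<^sup>*"
      by (rule strong_on_obtain_ear[OF strong \<open>H \<subseteq> V\<close> \<open>H \<noteq> {}\<close> R_def \<open>R \<noteq> {}\<close>,
            folded A_def B_def F_def])
    then obtain n w M' where w: "route n w" and M': "M' \<subseteq> R - w ` {..n}" "double_star F r s M'"
      using route_avoiding_double_star MF M \<open>M \<noteq> R\<close> by blast
    have wR: "w ` {..n} \<subseteq> R" using route_in_R[OF w] by auto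
    have ends: "w 0 \<in> A" "w n \<in> B" and steps: "\<And>i. i < n \<Longrightarrow> (w i, w (Suc i)) \<in> F"
      using w unfolding route_def by blast+
    obtain h h' where hh: "h \<in> H" "h' \<in> H" "(h, w 0) \<in> E" "(w n, h') \<in> E"
      using ends by (auto simp: A_def B_def)
    have "strong_on E (H \<union> w ` {..n})"
      using strong_on_add_ear[OF \<open>strong_on E H\<close> hh] steps by (auto simp: F_def)
    moreover have "H \<union> w ` {..n} \<subseteq> V" using wR \<open>H \<subseteq> V\<close> by (auto simp: R_def)
    moreover have "M' \<subseteq> V - (H \<union> w ` {..n})" using M'(1) by (auto simp: R_def)
    moreover have "double_star E r s M'" by (rule double_star_mono[OF M'(2)]) (auto simp: F_def)
    ultimately have "good (H \<union> w ` {..n})" unfolding good_def by blast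
    then have "H = H \<union> w ` {..n}" by (rule maximal) simp
    then have "w 0 \<in> H" by blast
    then show False using ends A_subset by (auto simp: R_def)
  qed
  then have "V - M = H" using H by (auto simp: R_def good_def)
  then show ?thesis using M H \<open>M = R\<close> by (intro exI[of _ M]) (auto simp: R_def good_def)
qed

section \<open>From arc relations back to digraphs\<close>

lemma strongly_connected_induce_iff:
  "strongly_connected (D \<restriction> X) \<longleftrightarrow> strong_on (arcs_ends D) X"
proof -
  have "(x, y) \<in> rtrancl_on X (arcs_ends (D \<restriction> X))"
    if "(x, y) \<in> rtrancl_on X (arcs_ends D)" for x y
    using that
  proof (induction rule: rtrancl_on_induct)
    case base
    then show ?case by simp
  next
    case (step y z)
    then have "(y, z) \<in> arcs_ends (D \<restriction> X)" by (auto simp: arcs_ends_conv)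
    then show ?case using step by (blast intro: rtrancl_on_into_rtrancl_on)
  qed
  moreover have "(x, y) \<in> rtrancl_on X (arcs_ends D)"
    if "(x, y) \<in> rtrancl_on X (arcs_ends (D \<restriction> X))" for x y
    using that
  proof (induction rule: rtrancl_on_induct)
    case base
    then show ?case by simp
  next
    case (step y z)
    then have "(y, z) \<in> arcs_ends D" by (auto simp: arcs_ends_conv)
    then show ?case using step by (blast intro: rtrancl_on_into_rtrancl_on)
  qed
  ultimately show ?thesis by (auto simp: strongly_connected_def strong_on_def reachable_def)
qed

context digraph
begin

lemma card_arcs_ends_Image: "card (arcs_ends G `` {v}) = out_degree G v"
proof -
  have "arcs_ends G `` {v} = head G ` out_arcs G v"
    by (auto simp: arcs_ends_conv out_arcs_def)
  moreover have "inj_on (head G) (out_arcs G v)"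
    using no_multi_arcs by (auto simp: inj_on_def out_arcs_def arc_to_ends_def)
  ultimately show ?thesis by (simp add: out_degree_def card_image)
qed

lemma card_arcs_ends_converse_Image: "card ((arcs_ends G)\<inverse> `` {v}) = in_degree G v"
proof -
  have "(arcs_ends G)\<inverse> `` {v} = tail G ` in_arcs G v"
    by (auto simp: arcs_ends_conv in_arcs_def)
  moreover have "inj_on (tail G) (in_arcs G v)"
    using no_multi_arcs by (auto simp: inj_on_def in_arcs_def arc_to_ends_def)
  ultimately show ?thesis by (simp add: in_degree_def card_image)
qed

text \<open>\<open>T\<close> keeps exactly the arcs of \<open>G\<close> whose pair of ends lies in
  \<open>K\<close>. Without parallel arcs, and with \<open>f\<close> injective, an arc is determined
  by the \<open>f\<close>-images of its ends, so these pairs can serve as the arcs of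
  \<open>S\<close>. This treats all three star shapes uniformly.\<close>

lemma subgraph_iso_of_ends:
  assumes K: "K \<subseteq> arcs_ends G" "K \<subseteq> M \<times> M" and M: "M \<subseteq> verts G" and f: "inj_on f M"
    and S: "verts S = f ` M" "arcs S = map_prod f f ` K" "tail S = fst" "head S = snd"
  shows "\<exists>T. verts T = M \<and> subgraph T G \<and> digraph_iso T (S :: ('c, 'c \<times> 'c) pre_digraph)"
proof -
  define T where "T = \<lparr>verts = M, arcs = {e \<in> arcs G. (tail G e, head G e) \<in> K},
    tail = tail G, head = head G\<rparr>"
  define h where "h = \<lparr>iso_verts = f, iso_arcs = (\<lambda>e. (f (tail G e), f (head G e))),
    iso_head = snd, iso_tail = fst\<rparr>"
  have wf: "wf_digraph T" using K by unfold_locales (auto simp: T_def)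
  have "subgraph T G"
    using wf M wf_digraph_axioms by (auto simp: subgraph_def T_def compatible_def)
  moreover have "pre_digraph.digraph_isomorphism T h"
    unfolding pre_digraph.digraph_isomorphism_def
  proof (intro conjI)
    show "inj_on (iso_arcs h) (arcs T)"
    proof (rule inj_onI)
      fix x y assume xy: "x \<in> arcs T" "y \<in> arcs T" "iso_arcs h x = iso_arcs h y"
      then have "{tail G x, tail G y, head G x, head G y} \<subseteq> M"
          "f (tail G x) = f (tail G y)" "f (head G x) = f (head G y)"
        using K(2) by (auto simp: T_def h_def)
      then have "tail G x = tail G y \<and> head G x = head G y" using inj_onD[OF f] by blast
      then show "x = y" using xy no_multi_arcs by (auto simp: T_def arc_to_ends_def)
    qed
  qed (use wf f in \<open>auto simp: T_def h_def\<close>)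
  moreover have "S = app_iso h T"
  proof (rule pre_digraph.equality)
    show "arcs S = arcs (app_iso h T)"
    proof -
      have "K = (\<lambda>e. (tail G e, head G e)) ` arcs T"
        using K(1) by (auto simp: T_def arcs_ends_conv)
      then show ?thesis by (simp add: S h_def image_image)
    qed
  qed (auto simp: S h_def T_def)
  ultimately show ?thesis by (intro exI[of _ T]) (auto simp: T_def digraph_iso_def)
qed

lemma subgraph_of_double_star:
  assumes "double_star (arcs_ends G) r s M" "M \<subseteq> verts G"
  shows "\<exists>T. verts T = M \<and> subgraph T G \<and> (\<exists>S\<in>{ODS r s, IDS r s, OIDS r s}. digraph_iso T S)"
proof -
  let ?E = "arcs_ends G"
  obtain u v X Y where M: "M = {u, v} \<union> X \<union> Y" "u \<noteq> v" "(u, v) \<in> ?E"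
      "finite X" "finite Y" "card X = r" "card Y = s" "X \<inter> Y = {}" "{u, v} \<inter> (X \<union> Y) = {}"
      and orient: "X \<subseteq> ?E `` {u} \<and> Y \<subseteq> ?E `` {v} \<or> X \<subseteq> ?E\<inverse> `` {u} \<and> Y \<subseteq> ?E\<inverse> `` {v}
        \<or> X \<subseteq> ?E `` {u} \<and> Y \<subseteq> ?E\<inverse> `` {v}"
    using assms(1) unfolding double_star_def by (elim exE conjE)
  obtain g where g: "bij_betw g X {1..r}"
    using M finite_same_card_bij[of X "{1..r}"] by auto
  obtain k where k: "bij_betw k Y {1..s}"
    using M finite_same_card_bij[of Y "{1..s}"] by auto
  \<comment> \<open>The leaves are numbered by \<open>g\<close> and \<open>k\<close>; on
    \<open>M\<close> the last branch is reached only by elements of \<open>Y\<close>.\<close>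
  define f where "f x = (if x = u then CentreU else if x = v then CentreV
    else if x \<in> X then LeafA (g x) else LeafB (k x))" for x
  have fu: "f u = CentreU" and fv: "f v = CentreV" using M by (auto simp: f_def)
  have fX: "f x = LeafA (g x)" if "x \<in> X" for x using that M by (auto simp: f_def)
  have fY: "f y = LeafB (k y)" if "y \<in> Y" for y using that M by (auto simp: f_def)
  have gX: "g ` X = {1..r}" "inj_on g X" and kY: "k ` Y = {1..s}" "inj_on k Y"
    using g k by (auto simp: bij_betw_def)
  have imX: "f ` X = LeafA ` {1..r}"
    unfolding gX(1)[symmetric] image_image using fX by auto
  have imY: "f ` Y = LeafB ` {1..s}"
    unfolding kY(1)[symmetric] image_image using fY by auto
  have inj: "inj_on f M"
    unfolding M(1) using gX(2) kY(2) fX fY fu fv by (auto simp: inj_on_def)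
  have verts: "f ` M = ds_verts r s"
    unfolding M(1) ds_verts_def by (simp add: image_Un fu fv imX imY)
  have times: "map_prod f f ` (P \<times> Q) = f ` P \<times> f ` Q" for P Q by auto
  consider (ODS) "X \<subseteq> ?E `` {u}" "Y \<subseteq> ?E `` {v}"
    | (IDS) "X \<subseteq> ?E\<inverse> `` {u}" "Y \<subseteq> ?E\<inverse> `` {v}"
    | (OIDS) "X \<subseteq> ?E `` {u}" "Y \<subseteq> ?E\<inverse> `` {v}"
    using orient by argo
  then show ?thesis
  proof cases
    case ODS
    have "\<exists>T. verts T = M \<and> subgraph T G \<and> digraph_iso T (ODS r s)"
    proof (rule subgraph_iso_of_ends[OF _ _ assms(2) inj])
      show "{(u, v)} \<union> {u} \<times> X \<union> {v} \<times> Y \<subseteq> ?E" using M ODS by auto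
      show "{(u, v)} \<union> {u} \<times> X \<union> {v} \<times> Y \<subseteq> M \<times> M" using M(1) by auto
      show "arcs (ODS r s) = map_prod f f ` ({(u, v)} \<union> {u} \<times> X \<union> {v} \<times> Y)"
        unfolding image_Un times imX imY by (auto simp: ODS_def fu fv)
    qed (auto simp: ODS_def verts)
    then show ?thesis by auto
  next
    case IDS
    have "\<exists>T. verts T = M \<and> subgraph T G \<and> digraph_iso T (IDS r s)"
    proof (rule subgraph_iso_of_ends[OF _ _ assms(2) inj])
      show "{(u, v)} \<union> X \<times> {u} \<union> Y \<times> {v} \<subseteq> ?E" using M IDS by auto
      show "{(u, v)} \<union> X \<times> {u} \<union> Y \<times> {v} \<subseteq> M \<times> M" using M(1) by auto
      show "arcs (IDS r s) = map_prod f f ` ({(u, v)} \<union> X \<times> {u} \<union> Y \<times> {v})"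
        unfolding image_Un times imX imY by (auto simp: IDS_def fu fv)
    qed (auto simp: IDS_def verts)
    then show ?thesis by auto
  next
    case OIDS
    have "\<exists>T. verts T = M \<and> subgraph T G \<and> digraph_iso T (OIDS r s)"
    proof (rule subgraph_iso_of_ends[OF _ _ assms(2) inj])
      show "{(u, v)} \<union> {u} \<times> X \<union> Y \<times> {v} \<subseteq> ?E" using M OIDS by auto
      show "{(u, v)} \<union> {u} \<times> X \<union> Y \<times> {v} \<subseteq> M \<times> M" using M(1) by auto
      show "arcs (OIDS r s) = map_prod f f ` ({(u, v)} \<union> {u} \<times> X \<union> Y \<times> {v})"
        unfolding image_Un times imX imY by (auto simp: OIDS_def fu fv)
    qed (auto simp: OIDS_def verts)
    then show ?thesis by auto
  qed
qed

end

theorem theorem4p4: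
  fixes D :: "('a, 'b) pre_digraph" and m r s :: nat
  assumes "1 \<le> r" and "r \<le> m - 3" and "1 \<le> s" and "s \<le> m - 3" and "r + s = m - 2"
    and "digraph D" and "strongly_connected D"
    and "min_semi_degree D \<ge> m + 1"
  shows "\<exists>T. subgraph T D \<and> (\<exists>S \<in> {ODS r s, IDS r s, OIDS r s}. digraph_iso T S)
           \<and> strongly_connected (D \<restriction> (verts D - verts T))"
proof -
  interpret digraph D by fact
  \<comment> \<open>Truncated subtraction does no harm: \<open>1 \<le> r\<close> and
    \<open>r \<le> m - 3\<close> force \<open>m\<close> to be at least 4.\<close>
  have m: "m + 1 = r + s + 3" using assms(1-5) by linarith
  have deg: "r + s + 3 \<le> out_degree D x" "r + s + 3 \<le> in_degree D x" if "x \<in> verts D" for x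
  proof -
    have "min_out_degree D \<le> out_degree D x" "min_in_degree D \<le> in_degree D x"
      using that by (auto simp: min_out_degree_def min_in_degree_def)
    then show "r + s + 3 \<le> out_degree D x" "r + s + 3 \<le> in_degree D x"
      using assms(8) m unfolding min_semi_degree_def by linarith+
  qed
  have "strong_on (arcs_ends D) (verts D)"
    using \<open>strongly_connected D\<close> by (simp add: strongly_connected_def strong_on_def reachable_def)
  moreover have "(x, x) \<notin> arcs_ends D" for x
    using no_loops by (auto simp: arcs_ends_conv)
  moreover have "arcs_ends D \<subseteq> verts D \<times> verts D" by (auto simp: arcs_ends_conv)
  ultimately obtain M where M: "M \<subseteq> verts D" "double_star (arcs_ends D) r s M"
      "strong_on (arcs_ends D) (verts D - M)"
    using strong_on_double_star_removal[of "verts D" "arcs_ends D" r s] deg assms(1,3)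
    by (auto simp: card_arcs_ends_Image card_arcs_ends_converse_Image)
  then show ?thesis
    using subgraph_of_double_star[OF M(2,1)] by (metis strongly_connected_induce_iff)
qed

end
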